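(* No distributed algorithm (in the LOCAL model) can $4$-color every $n$-vertex planar graph in $o(n)$ rounds. That is, there is no distributed algorithm and no function $r(n)=o(n)$ such that, for every $n$, the algorithm finds a coloring with colors $\{1,2,3,4\}$ of every $n$-vertex planar graph (with any assignment of identifiers) in at most $r(n)$ rounds.
   Context: Graphs are finite and simple. A coloring assigns colors to vertices so that adjacent vertices get different colors. LOCAL model: each node of an $n$-vertex graph $G$ has a unique identifier (an integer between $1$ and $n$) and exchanges messages with its neighbors in synchronous rounds. There is no bound on message size and nodes have infinite computational power. Initially each node knows only its own identifier and the number $n$ of vertices (and the number of colors). At the end each vertex must output its own color. The round complexity is the number of rounds until every vertex has chosen its output; with round complexity $r$, the output of each vertex depends only on the labelled ball of radius $r$ around it. *)

theory Defs
  imports "HOL-Analysis.Analysis" "HOL-Library.Landau_Symbols" "Graph_Theory.Pair_Digraph"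
begin

text \<open>
  A finite simple graph is a \<^locale>\<open>pair_graph\<close>: finitely many vertices and a symmetric,
  loop-free set of arcs, each edge \<open>uv\<close> being represented by the two arcs \<open>(u, v)\<close> and \<open>(v, u)\<close>.
\<close>

section \<open>Planar graphs\<close>

text \<open>
  The curves are indexed by unordered edges \<open>{u, v}\<close>, so both arcs of an edge share one curve, which
  may be traversed in either direction. Two distinct edges meet at most in a common end.
\<close>

definition plane_drawing ::
  "'v pair_pre_digraph \<Rightarrow> ('v \<Rightarrow> complex) \<Rightarrow> ('v set \<Rightarrow> real \<Rightarrow> complex) \<Rightarrow> bool" where
  "plane_drawing G p \<gamma> \<longleftrightarrow>
     inj_on p (pverts G) \<and>
     (\<forall>(u, v) \<in> parcs G.
        arc (\<gamma> {u, v}) \<and>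
        {pathstart (\<gamma> {u, v}), pathfinish (\<gamma> {u, v})} = {p u, p v} \<and>
        path_image (\<gamma> {u, v}) \<inter> p ` pverts G = {p u, p v}) \<and>
     (\<forall>(u, v) \<in> parcs G. \<forall>(x, y) \<in> parcs G.
        {u, v} \<noteq> {x, y} \<longrightarrow>
        path_image (\<gamma> {u, v}) \<inter> path_image (\<gamma> {x, y}) \<subseteq> p ` ({u, v} \<inter> {x, y}))"

definition planar :: "'v pair_pre_digraph \<Rightarrow> bool" where
  "planar G \<longleftrightarrow> (\<exists>p \<gamma>. plane_drawing G p \<gamma>)"

section \<open>Colorings\<close>

definition proper_coloring :: "'v pair_pre_digraph \<Rightarrow> nat \<Rightarrow> ('v \<Rightarrow> nat) \<Rightarrow> bool" where
  "proper_coloring G k c \<longleftrightarrow>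
     (\<forall>v \<in> pverts G. c v \<in> {1..k}) \<and> (\<forall>(u, v) \<in> parcs G. c u \<noteq> c v)"

section \<open>The LOCAL model\<close>

text \<open>
  The types \<open>'s\<close> of states and \<open>'m\<close> of messages and the functions on them are arbitrary (unbounded
  messages and computational power).

  \<^item> \<open>init n k i\<close>: initial state of the node with identifier \<open>i\<close>, knowing the number \<open>n\<close> of vertices
    and the number \<open>k\<close> of colors;
  \<^item> \<open>send s j\<close>: message that a node in state \<open>s\<close> sends in one round to its neighbor with identifier
    \<open>j\<close>, if it has one; distinct neighbors may be sent distinct messages, but sending
    tells the sender nothing about which identifiers occur in its neighborhood;
  \<^item> \<open>recv s M\<close>: next state, where \<open>M\<close> is the set of all messages received in the round, each tagged
    with the identifier of its sender;
  \<^item> \<open>choice s\<close>: the chosen color, or \<open>None\<close> if no color has been chosen yet.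
\<close>

record ('s, 'm) local_algorithm =
  init :: "nat \<Rightarrow> nat \<Rightarrow> nat \<Rightarrow> 's"
  send :: "'s \<Rightarrow> nat \<Rightarrow> 'm"
  recv :: "'s \<Rightarrow> (nat \<times> 'm) set \<Rightarrow> 's"
  choice :: "'s \<Rightarrow> nat option"

fun local_state ::
  "('s, 'm) local_algorithm \<Rightarrow> nat \<Rightarrow> 'v pair_pre_digraph \<Rightarrow> ('v \<Rightarrow> nat) \<Rightarrow> nat \<Rightarrow> 'v \<Rightarrow> 's" where
  "local_state A k G ident 0 v = init A (card (pverts G)) k (ident v)"
| "local_state A k G ident (Suc t) v =
     recv A (local_state A k G ident t v)
       {(ident u, send A (local_state A k G ident t u) (ident v)) | u. (u, v) \<in> parcs G}"

text \<open>
  The first color chosen by a node is final; afterwards the node may still take part in the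
  communication, but later values of \<open>choice\<close> are ignored.
\<close>

definition chooses_color ::
  "('s, 'm) local_algorithm \<Rightarrow> nat \<Rightarrow> 'v pair_pre_digraph \<Rightarrow> ('v \<Rightarrow> nat) \<Rightarrow> nat \<Rightarrow> 'v \<Rightarrow> nat \<Rightarrow> bool" where
  "chooses_color A k G ident t v c \<longleftrightarrow>
     choice A (local_state A k G ident t v) = Some c \<and>
     (\<forall>s < t. choice A (local_state A k G ident s v) = None)"

definition finds_coloring_within ::
  "('s, 'm) local_algorithm \<Rightarrow> nat \<Rightarrow> 'v pair_pre_digraph \<Rightarrow> ('v \<Rightarrow> nat) \<Rightarrow> real \<Rightarrow> bool" where
  "finds_coloring_within A k G ident T \<longleftrightarrow>
     (\<exists>c. proper_coloring G k c \<and>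
          (\<forall>v \<in> pverts G. \<exists>t. real t \<le> T \<and> chooses_color A k G ident t v (c v)))"

definition identifier_assignment :: "'v pair_pre_digraph \<Rightarrow> ('v \<Rightarrow> nat) \<Rightarrow> bool" where
  "identifier_assignment G ident \<longleftrightarrow> bij_betw ident (pverts G) {1..card (pverts G)}"

end

theory Submission
  imports Defs
begin

text \<open>
  The cube of a path is planar, and since any four consecutive vertices form a clique, each of its
  4-colorings is periodic with period 4. Moving one vertex from the middle of the path to its end
  shifts everything in between by one position, which an algorithm running for few rounds cannot
  notice at two vertices that are far away from the places of change. These two vertices thus keep
  their colors, although their distance modulo 4 has changed.
\<close>

section \<open>Locality\<close>

text \<open>\<open>D t\<close> stands for vertices whose view of radius \<open>t\<close> survives
  the map \<open>\<phi>\<close>. A vertex of \<open>D (Suc t)\<close> has all its neighbors in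
  \<open>D t\<close>, so by induction it receives the same set of tagged messages in both
  graphs.\<close>

lemma local_state_transfer:
  fixes G :: "'v pair_pre_digraph" and G' :: "'w pair_pre_digraph"
  assumes card: "card (pverts G') = card (pverts G)"
    and ident: "\<And>v. v \<in> D 0 \<Longrightarrow> ident' (\<phi> v) = ident v"
    and decreasing: "\<And>t. D (Suc t) \<subseteq> D t"
    and inside: "\<And>t v. v \<in> D (Suc t) \<Longrightarrow> {u. (u, v) \<in> parcs G} \<subseteq> D t"
    and neighbors: "\<And>t v. v \<in> D (Suc t) \<Longrightarrow>
      {u. (u, \<phi> v) \<in> parcs G'} = \<phi> ` {u. (u, v) \<in> parcs G}"
    and "v \<in> D t"
  shows "local_state A k G' ident' t (\<phi> v) = local_state A k G ident t v"
  using \<open>v \<in> D t\<close>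
proof (induction t arbitrary: v)
  case 0
  then show ?case by (simp add: card ident)
next
  case (Suc t)
  have D: "D t \<subseteq> D 0" for t
    by (induction t) (use decreasing in auto)
  have v: "v \<in> D t"
    using Suc.prems decreasing by blast
  let ?N = "{u. (u, v) \<in> parcs G}"
  let ?f = "\<lambda>u. (ident u, send A (local_state A k G ident t u) (ident v))"
  let ?f' = "\<lambda>u. (ident' u, send A (local_state A k G' ident' t u) (ident' (\<phi> v)))"
  have "?f' (\<phi> u) = ?f u" if "u \<in> ?N" for u
  proof -
    have "u \<in> D t" using inside[OF Suc.prems] that by auto
    then show ?thesis using D v Suc.IH by (auto simp: ident subset_iff)
  qed
  then have "?f' ` \<phi> ` ?N = ?f ` ?N"
    by (simp add: image_image)
  then have "?f' ` {u. (u, \<phi> v) \<in> parcs G'} = ?f ` ?N"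
    using neighbors[OF Suc.prems] by simp
  moreover have "{?f' u | u. (u, \<phi> v) \<in> parcs G'} = ?f' ` {u. (u, \<phi> v) \<in> parcs G'}"
    and "{?f u | u. (u, v) \<in> parcs G} = ?f ` ?N"
    by blast+
  ultimately show ?case
    using Suc.IH[OF v] by simp
qed

text \<open>A choice counts only at the first time it is made; equal states up to \<open>R\<close>
  force equal first times, hence equal colors.\<close>

lemma chooses_color_unique:
  assumes "chooses_color A k G ident t v c" "chooses_color A k G' ident' t' v' c'"
    and "t \<le> R" "t' \<le> R"
    and "\<And>s. s \<le> R \<Longrightarrow> local_state A k G' ident' s v' = local_state A k G ident s v"
  shows "c' = c"
proof -
  have "t = t'"
    using assms unfolding chooses_color_def
    by (metis linorder_neqE_nat option.distinct(1) less_imp_le_nat)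
  then show ?thesis
    using assms unfolding chooses_color_def by auto
qed

section \<open>The cube of a path\<close>

definition path_cube :: "nat \<Rightarrow> nat pair_pre_digraph" where
  "path_cube n = \<lparr>pverts = {..<n},
     parcs = {(u, v). u < n \<and> v < n \<and> u \<noteq> v \<and> u \<le> v + 3 \<and> v \<le> u + 3}\<rparr>"

lemma pverts_path_cube [simp]: "pverts (path_cube n) = {..<n}"
  by (simp add: path_cube_def)

lemma parcs_path_cube [simp]:
  "(u, v) \<in> parcs (path_cube n) \<longleftrightarrow> u < n \<and> v < n \<and> u \<noteq> v \<and> u \<le> v + 3 \<and> v \<le> u + 3"
  by (simp add: path_cube_def)

lemma pair_graph_path_cube: "pair_graph (path_cube n)"
proof
  show "finite (parcs (path_cube n))"
    by (rule finite_subset[of _ "{..<n} \<times> {..<n}"]) auto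
  show "symmetric (path_cube n)"
    by (auto simp: symmetric_def sym_def)
qed auto

lemma proper_4_coloring_path_cube_periodic:
  assumes c: "proper_coloring (path_cube n) 4 c" and "v + 4 * j < n"
  shows "c (v + 4 * j) = c v"
  using \<open>v + 4 * j < n\<close>
proof (induction j)
  case (Suc j)
  define u where "u = v + 4 * j"
  have u: "u + 4 < n" using Suc.prems by (simp add: u_def)
  have ne: "c x \<noteq> c y" if "x < y" "y < n" "y \<le> x + 3" for x y
    using c that by (auto simp: proper_coloring_def)
  have range: "1 \<le> c x \<and> c x \<le> 4" if "x < n" for x
    using c that by (auto simp: proper_coloring_def)
  have "c (u + 4) = c u"
  proof (rule ccontr)
    assume "c (u + 4) \<noteq> c u"
    \<comment> \<open>Among five consecutive vertices only the two outermost are non-adjacent, so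
      distinct colors at these would require five colors.\<close>
    have "c x \<noteq> c y" if "x < y" "x \<in> {u..u + 4}" "y \<in> {u..u + 4}" for x y
    proof (cases "y \<le> x + 3")
      case False
      then have "x = u" "y = u + 4" using that by auto
      then show ?thesis using \<open>c (u + 4) \<noteq> c u\<close> by simp
    qed (use ne[of x y] that u in auto)
    then have "inj_on c {u..u + 4}"
      by (rule linorder_inj_onI') auto
    moreover have "c ` {u..u + 4} \<subseteq> {1..4}"
      using range u by auto
    ultimately have "card {u..u + 4} \<le> card {1..4::nat}"
      by (intro card_inj_on_le) auto
    then show False by simp
  qed
  then show ?case using Suc by (simp add: u_def algebra_simps)
qed simp

section \<open>Planarity of path cubes\<close>

text \<open>
  Vertex \<open>i + 3\<close> is placed at the centroid of the vertices \<open>i\<close>, \<open>i + 1\<close> and \<open>i + 2\<close>; all later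
  vertices lie in the triangle of \<open>i + 1\<close>, \<open>i + 2\<close> and \<open>i + 3\<close>. Since \<open>3z\<^sup>3 = 1 + z + z\<^sup>2\<close> has the
  factorization \<open>(z - 1) (3z\<^sup>2 + 2z + 1) = 0\<close>, this is solved by the iterates of a linear map with
  the companion matrix of \<open>z\<^sup>2 + 2/3 z + 1/3\<close>.
\<close>

definition spiral_step :: "complex \<Rightarrow> complex" where
  "spiral_step w = Complex (- Im w / 3) (Re w - 2 * Im w / 3)"

definition spiral :: "nat \<Rightarrow> complex" where
  "spiral i = (spiral_step ^^ i) 1"

text \<open>The closed triangle with corners \<open>spiral 1\<close>, \<open>spiral 2\<close> and
  \<open>spiral 3\<close>, given by its three sides.\<close>

definition spiral_triangle :: "complex set" where
  "spiral_triangle = {w. 5 * Re w - Im w \<ge> - 1 \<and> 7 * Re w - 5 * Im w \<le> 1 \<and> 4 * Re w + Im w \<le> 1}"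

lemma linear_spiral_step_power: "linear (spiral_step ^^ i)"
proof (induction i)
  case 0
  then show ?case by (simp add: linear_id[unfolded id_def] id_def)
next
  case (Suc i)
  have "linear spiral_step"
    by (rule linearI) (simp_all add: spiral_step_def complex_eq_iff field_simps)
  from linear_compose[OF Suc this] show ?case by (simp add: comp_def)
qed

lemma inj_spiral_step_power: "inj (spiral_step ^^ i)"
proof -
  have "inj spiral_step"
    by (auto simp: inj_def spiral_step_def complex_eq_iff)
  then show ?thesis by (induction i) (auto intro: inj_compose)
qed

lemma spiral_add: "spiral (i + j) = (spiral_step ^^ i) (spiral j)"
  by (simp add: spiral_def funpow_add)

lemma spiral_values:
  "spiral 0 = 1" "spiral 1 = Complex 0 1" "spiral 2 = Complex (- 1/3) (- 2/3)"
  "spiral 3 = Complex (2/9) (1/9)"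
  by (simp_all add: spiral_def spiral_step_def numeral_2_eq_2 numeral_3_eq_3 complex_eq_iff)

lemma convex_spiral_triangle: "convex spiral_triangle"
proof -
  have *: "spiral_triangle = {w. Complex (-5) 1 \<bullet> w \<le> 1} \<inter> {w. Complex 7 (-5) \<bullet> w \<le> 1}
      \<inter> {w. Complex 4 1 \<bullet> w \<le> 1}"
    by (auto simp: spiral_triangle_def inner_complex_def)
  show ?thesis
    unfolding * by (intro convex_Int convex_halfspace_le)
qed

text \<open>The triangle is invariant under \<open>spiral_step\<close>: its image has the corners
  \<open>spiral 2\<close>, \<open>spiral 3\<close> and the centroid \<open>spiral 4\<close>.\<close>

lemma spiral_in_triangle: "i \<ge> 1 \<Longrightarrow> spiral i \<in> spiral_triangle"
proof (induction i rule: dec_induct)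
  case base
  show ?case unfolding spiral_values by (simp add: spiral_triangle_def)
next
  case (step i)
  then show ?case by (auto simp: spiral_def spiral_step_def spiral_triangle_def)
qed

lemma spiral_edge_Int_triangle:
  assumes "d \<in> {1..3}"
  shows "closed_segment 1 (spiral d) \<inter> spiral_triangle \<subseteq> {spiral d}"
proof
  fix w assume w: "w \<in> closed_segment 1 (spiral d) \<inter> spiral_triangle"
  then obtain t where t: "0 \<le> t" "t \<le> 1" "w = (1 - t) *\<^sub>R 1 + t *\<^sub>R spiral d"
    by (auto simp: closed_segment_def)
  have d: "d = 1 \<or> d = 2 \<or> d = 3" using assms by auto
  \<comment> \<open>For each \<open>d\<close>, some side through \<open>spiral d\<close> has the
    point 1 strictly on its outer side; its inequality fails for all \<open>t < 1\<close>.\<close>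
  then have "t \<ge> 1" using w t
    by (elim disjE) (simp_all only: spiral_values, auto simp: spiral_triangle_def)
  then show "w \<in> {spiral d}" using t by simp
qed

lemma spiral_edges_Int:
  assumes "d \<in> {1..3}" "e \<in> {1..3}" "d \<noteq> e"
  shows "closed_segment 1 (spiral d) \<inter> closed_segment 1 (spiral e) \<subseteq> {1}"
proof
  fix w assume w: "w \<in> closed_segment 1 (spiral d) \<inter> closed_segment 1 (spiral e)"
  then obtain t where t: "w = (1 - t) *\<^sub>R 1 + t *\<^sub>R spiral d"
    by (auto simp: closed_segment_def)
  from w obtain s where s: "w = (1 - s) *\<^sub>R 1 + s *\<^sub>R spiral e"
    by (auto simp: closed_segment_def)
  have "d = 1 \<or> d = 2 \<or> d = 3" "e = 1 \<or> e = 2 \<or> e = 3" using assms by auto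
  \<comment> \<open>The three directions from 1 to \<open>spiral 1\<close>, \<open>spiral 2\<close>,
    \<open>spiral 3\<close> are pairwise linearly independent.\<close>
  then have "t = 0" using \<open>d \<noteq> e\<close> trans[OF t[symmetric] s]
    by (elim disjE) (simp_all only: spiral_values, auto simp: complex_eq_iff)
  then show "w \<in> {1}" using t by simp
qed

section \<open>Intersections of the edges of the spiral drawing\<close>

definition spiral_edge :: "nat \<Rightarrow> nat \<Rightarrow> complex set" where
  "spiral_edge u v = closed_segment (spiral u) (spiral v)"

text \<open>The drawing is self-similar, so claims about edges leaving vertex \<open>u\<close>
  reduce to the three edges leaving vertex 0.\<close>

lemma spiral_edge_add: "spiral_edge u (u + d) = (spiral_step ^^ u) ` closed_segment 1 (spiral d)"
  using closed_segment_linear_image[OF linear_spiral_step_power, of u 1 "spiral d"]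
  by (simp add: spiral_edge_def spiral_add) (simp add: spiral_def)

lemma spiral_in_image_triangle:
  assumes "u < w"
  shows "spiral w \<in> (spiral_step ^^ u) ` spiral_triangle"
  using spiral_in_triangle[of "w - u"] spiral_add[of u "w - u"] assms by auto

lemma spiral_edge_Int_image_triangle:
  assumes "u < v" "v \<le> u + 3"
  shows "spiral_edge u v \<inter> (spiral_step ^^ u) ` spiral_triangle \<subseteq> {spiral v}"
proof -
  obtain d where v: "v = u + d" and d: "d \<in> {1..3}"
    using assms by (auto simp: less_iff_Suc_add)
  show ?thesis
    using spiral_edge_Int_triangle[OF d]
    unfolding v spiral_edge_add image_Int[OF inj_spiral_step_power, symmetric]
    by (auto simp: spiral_add)
qed

lemma spiral_edge_subset_image_triangle:
  assumes "u < x" "x < y"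
  shows "spiral_edge x y \<subseteq> (spiral_step ^^ u) ` spiral_triangle"
  unfolding spiral_edge_def using assms
  by (intro closed_segment_subset spiral_in_image_triangle convex_linear_image
      linear_spiral_step_power convex_spiral_triangle) auto

text \<open>If vertex \<open>u\<close> coincided with a later one, it would lie in its own triangle.
  Its edges to \<open>u + 1\<close> and \<open>u + 2\<close> meet that triangle only in their far
  ends, which would then coincide.\<close>

lemma spiral_neq: "u < v \<Longrightarrow> spiral u \<noteq> spiral v"
proof
  assume "u < v" "spiral u = spiral v"
  then have "spiral u \<in> spiral_edge u (u + 1) \<inter> (spiral_step ^^ u) ` spiral_triangle"
    and "spiral u \<in> spiral_edge u (u + 2) \<inter> (spiral_step ^^ u) ` spiral_triangle"
    using spiral_in_image_triangle[of u v] by (auto simp: spiral_edge_def)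
  then have "spiral (u + 1) = spiral (u + 2)"
    using spiral_edge_Int_image_triangle[of u "u + 1"] spiral_edge_Int_image_triangle[of u "u + 2"]
    by fastforce
  then have "spiral 1 = spiral 2"
    using inj_spiral_step_power[of u] by (simp only: spiral_add inj_eq)
  then show False by (simp only: spiral_values) simp
qed

lemma inj_spiral: "inj spiral"
  by (rule linorder_injI) (rule spiral_neq)

text \<open>An edge between vertices later than \<open>w\<close> lies in the triangle of
  \<open>w\<close>, which does not contain \<open>spiral w\<close>. A vertex later than
  \<open>u\<close> lies in the triangle of \<open>u\<close>, which the edge touches only at
  \<open>spiral v\<close>.\<close>

lemma spiral_in_edge:
  assumes "u < v" "v \<le> u + 3" "spiral w \<in> spiral_edge u v"
  shows "w = u \<or> w = v"
proof (cases w u rule: linorder_cases)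
  case less
  have "spiral w \<in> (spiral_step ^^ w) ` spiral_triangle"
    using spiral_edge_subset_image_triangle[OF less] assms by blast
  then have "spiral w \<in> spiral_edge w (w + 1) \<inter> (spiral_step ^^ w) ` spiral_triangle"
    by (simp add: spiral_edge_def)
  then have "spiral w = spiral (w + 1)"
    using spiral_edge_Int_image_triangle[of w "w + 1"] by auto
  then show ?thesis using spiral_neq[of w "w + 1"] by simp
next
  case greater
  then have "spiral w = spiral v"
    using spiral_edge_Int_image_triangle[of u v] spiral_in_image_triangle[of u w] assms by blast
  then show ?thesis using inj_spiral by (simp add: inj_eq)
qed simp

text \<open>For \<open>u < x\<close> the second edge lies in the triangle of \<open>u\<close>, so
  the edges can meet only at \<open>spiral v\<close>, which must then be an end of the second
  edge.\<close>

lemma spiral_edges_disjoint: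
  assumes "u < v" "v \<le> u + 3" "x < y" "y \<le> x + 3" "(u, v) \<noteq> (x, y)" "u \<le> x"
  shows "spiral_edge u v \<inter> spiral_edge x y \<subseteq> spiral ` ({u, v} \<inter> {x, y})"
proof (cases "u = x")
  case True
  define d e where "d = v - u" and "e = y - u"
  then have v: "v = u + d" "y = u + e" and d: "d \<in> {1..3}" "e \<in> {1..3}" "d \<noteq> e"
    using assms True by auto
  have "spiral_edge u v \<inter> spiral_edge u y \<subseteq> {spiral u}"
    using spiral_edges_Int[OF d]
    unfolding v spiral_edge_add image_Int[OF inj_spiral_step_power, symmetric]
    by (auto simp: spiral_def)
  then show ?thesis using True by auto
next
  case False
  then have "spiral_edge x y \<subseteq> (spiral_step ^^ u) ` spiral_triangle"
    using assms by (intro spiral_edge_subset_image_triangle) auto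
  then have "spiral_edge u v \<inter> spiral_edge x y \<subseteq> {spiral v} \<inter> spiral_edge x y"
    using spiral_edge_Int_image_triangle[of u v] assms by blast
  also have "\<dots> \<subseteq> spiral ` ({u, v} \<inter> {x, y})"
    using spiral_in_edge[of x y v] assms by auto
  finally show ?thesis .
qed

lemma planar_path_cube: "planar (path_cube n)"
proof -
  \<comment> \<open>Curves are indexed by unordered edges, so each is directed from its smaller to
    its larger end.\<close>
  define \<gamma> where "\<gamma> = (\<lambda>S :: nat set. linepath (spiral (Min S)) (spiral (Max S)))"
  have img: "path_image (\<gamma> {u, v}) = spiral_edge (min u v) (max u v)" for u v
    by (simp add: \<gamma>_def spiral_edge_def)
  have ends: "{pathstart (\<gamma> {u, v}), pathfinish (\<gamma> {u, v})} = {spiral u, spiral v}" for u v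
    by (auto simp: \<gamma>_def min_def max_def)
  have arc: "arc (\<gamma> {u, v})" if "u \<noteq> v" for u v
    using that inj_spiral by (auto simp: \<gamma>_def min_def max_def inj_eq)
  have vertices: "path_image (\<gamma> {u, v}) \<inter> spiral ` {..<n} = {spiral u, spiral v}"
    if "u < n" "v < n" "u \<noteq> v" "u \<le> v + 3" "v \<le> u + 3" for u v
  proof -
    have "w = u \<or> w = v" if "spiral w \<in> spiral_edge (min u v) (max u v)" for w
      using spiral_in_edge[OF _ _ that] \<open>u \<noteq> v\<close> \<open>u \<le> v + 3\<close> \<open>v \<le> u + 3\<close> by linarith
    moreover have "spiral u \<in> spiral_edge (min u v) (max u v)"
      "spiral v \<in> spiral_edge (min u v) (max u v)"
      by (auto simp: spiral_edge_def min_def max_def)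
    ultimately show ?thesis using that by (auto simp: img)
  qed
  have cross: "path_image (\<gamma> {u, v}) \<inter> path_image (\<gamma> {x, y}) \<subseteq> spiral ` ({u, v} \<inter> {x, y})"
    if "u \<noteq> v" "u \<le> v + 3" "v \<le> u + 3" "x \<noteq> y" "x \<le> y + 3" "y \<le> x + 3"
      "{u, v} \<noteq> {x, y}" for u v x y
  proof -
    define a b a' b' where ab: "a = min u v" "b = max u v" "a' = min x y" "b' = max x y"
    have uv: "{u, v} = {a, b}" "{x, y} = {a', b'}"
      by (auto simp: ab min_def max_def)
    have *: "a < b" "b \<le> a + 3" "a' < b'" "b' \<le> a' + 3" "(a, b) \<noteq> (a', b')"
      using that uv by (auto simp: ab)
    have "spiral_edge a b \<inter> spiral_edge a' b' \<subseteq> spiral ` ({a, b} \<inter> {a', b'})"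
      using spiral_edges_disjoint[of a b a' b'] spiral_edges_disjoint[of a' b' a b] *
      by (metis Int_commute linorder_linear)
    then show ?thesis unfolding img uv[symmetric] ab[symmetric] .
  qed
  have "plane_drawing (path_cube n) spiral \<gamma>"
    unfolding plane_drawing_def
  proof (intro conjI ballI case_prodI2 impI)
    show "inj_on spiral (pverts (path_cube n))"
      using inj_spiral by (rule inj_on_subset) simp
  qed (use arc ends vertices cross in simp_all)
  then show ?thesis unfolding planar_def by blast
qed

section \<open>Moving a vertex to the end\<close>

text \<open>The graph stays fixed and only the identifiers move: along the path they read 1, ..., m,
  m + 2, ..., n, m + 1.\<close>

definition moved_ident :: "nat \<Rightarrow> nat \<Rightarrow> nat \<Rightarrow> nat" where
  "moved_ident n m v = (if v < m then Suc v else if Suc v < n then Suc (Suc v) else Suc m)"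

lemma identifier_assignment_Suc: "identifier_assignment (path_cube n) Suc"
  by (auto simp: identifier_assignment_def bij_betw_def image_Suc_lessThan)

lemma identifier_assignment_moved_ident:
  assumes "m < n"
  shows "identifier_assignment (path_cube n) (moved_ident n m)"
proof -
  have inj: "inj_on (moved_ident n m) {..<n}"
    using assms by (auto simp: inj_on_def moved_ident_def split: if_splits)
  moreover have "moved_ident n m ` {..<n} \<subseteq> {1..n}"
    using assms by (auto simp: moved_ident_def)
  ultimately have "moved_ident n m ` {..<n} = {1..n}"
    by (intro card_subset_eq) (auto simp: card_image)
  with inj show ?thesis
    by (simp add: identifier_assignment_def bij_betw_def)
qed

text \<open>One round carries information over at most three positions, so nothing from position
  \<open>m\<close> onwards is visible.\<close>

lemma local_state_moved_ident_before:
  assumes "v + 3 * t < m"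
  shows "local_state A k (path_cube n) (moved_ident n m) t v = local_state A k (path_cube n) Suc t v"
  by (rule local_state_transfer[where D = "\<lambda>t. {v. v + 3 * t < m}" and \<phi> = "\<lambda>v. v"])
    (use assms in \<open>auto simp: moved_ident_def\<close>)

text \<open>Beyond \<open>m\<close> every identifier sits one position further left. The bounds keep
  the view clear of position \<open>m\<close> and of the right end of the path.\<close>

lemma local_state_moved_ident_after:
  assumes "m + 3 * t < v" "v + 3 * t < n"
  shows "local_state A k (path_cube n) (moved_ident n m) t (v - 1) =
    local_state A k (path_cube n) Suc t v"
proof (rule local_state_transfer[where D = "\<lambda>t. {v. m + 3 * t < v \<and> v + 3 * t < n}"
      and \<phi> = "\<lambda>v. v - 1"])
  fix t v assume v: "v \<in> {v. m + 3 * Suc t < v \<and> v + 3 * Suc t < n}"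
  show "{u. (u, v - 1) \<in> parcs (path_cube n)} = (\<lambda>v. v - 1) ` {u. (u, v) \<in> parcs (path_cube n)}"
  proof (intro equalityI subsetI)
    fix u assume "u \<in> {u. (u, v - 1) \<in> parcs (path_cube n)}"
    then have "Suc u \<in> {u. (u, v) \<in> parcs (path_cube n)}" using v by auto
    then show "u \<in> (\<lambda>v. v - 1) ` {u. (u, v) \<in> parcs (path_cube n)}"
      by (intro image_eqI[where x = "Suc u"]) auto
  qed (use v in auto)
qed (use assms in \<open>auto simp: moved_ident_def\<close>)

section \<open>Contradiction between the colorings for two identifier assignments\<close>

theorem theorem1p5:
  shows "\<not> (\<exists>(A :: ('s, 'm) local_algorithm) (r :: nat \<Rightarrow> real).
    r \<in> o(\<lambda>n. real n) \<and>
    (\<forall>(n :: nat) (G :: nat pair_pre_digraph) (ident :: nat \<Rightarrow> nat).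
       pair_graph G \<and> card (pverts G) = n \<and> planar G \<and> identifier_assignment G ident \<longrightarrow>
       finds_coloring_within A 4 G ident (r n)))"
proof (rule notI, elim exE conjE)
  fix A :: "('s, 'm) local_algorithm" and r :: "nat \<Rightarrow> real"
  assume r: "r \<in> o(\<lambda>n. real n)"
    and A: "\<forall>(n :: nat) (G :: nat pair_pre_digraph) (ident :: nat \<Rightarrow> nat).
       pair_graph G \<and> card (pverts G) = n \<and> planar G \<and> identifier_assignment G ident \<longrightarrow>
       finds_coloring_within A 4 G ident (r n)"
  have "\<forall>\<^sub>F n in at_top. norm (r n) \<le> 1/12 * norm (real n)"
    using landau_o.smallD[OF r, of "1/12"] by simp
  then obtain N where N: "\<And>n. n \<ge> N \<Longrightarrow> \<bar>r n\<bar> \<le> real n / 12"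
    by (auto simp: eventually_at_top_linorder)
  \<comment> \<open>With \<open>n = 12 * q\<close> the running time is at most \<open>q\<close>, so
    a node sees at most \<open>3 * q\<close> positions to each side. The choice of \<open>m\<close>
    hides the change from vertex 0, and vertex \<open>8 * q\<close> is more than
    \<open>3 * q\<close> away from both \<open>m\<close> and the last vertex or exactly clear of
    them as the bounds \<open>6 * q + 1 < 8 * q\<close> and \<open>11 * q < 12 * q\<close>
    express.\<close>
  define q where "q = Suc N"
  define n where "n = 12 * q"
  define m where "m = 3 * q + 1"
  have q: "q \<ge> 1" by (simp add: q_def)
  have rn: "r n \<le> real q"
    using N[of n] by (simp add: n_def q_def)
  have finds: "finds_coloring_within A 4 (path_cube n) ident (r n)"
    if "identifier_assignment (path_cube n) ident" for ident
    using A[rule_format, of "path_cube n" n ident] that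
    by (simp add: pair_graph_path_cube planar_path_cube)
  obtain c where c: "proper_coloring (path_cube n) 4 c"
    and c_chosen: "\<And>v. v < n \<Longrightarrow> \<exists>t\<le>q. chooses_color A 4 (path_cube n) Suc t v (c v)"
    using finds[OF identifier_assignment_Suc] rn unfolding finds_coloring_within_def
    by (metis lessThan_iff of_nat_le_iff order_trans pverts_path_cube)
  have "m < n" using q by (simp add: m_def n_def)
  then obtain c' where c': "proper_coloring (path_cube n) 4 c'"
    and c'_chosen: "\<And>v. v < n \<Longrightarrow>
      \<exists>t\<le>q. chooses_color A 4 (path_cube n) (moved_ident n m) t v (c' v)"
    using finds[OF identifier_assignment_moved_ident] rn unfolding finds_coloring_within_def
    by (metis lessThan_iff of_nat_le_iff order_trans pverts_path_cube)
  have same_color: "c' v' = c v"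
    if "v < n" "v' < n" "\<And>s. s \<le> q \<Longrightarrow>
      local_state A 4 (path_cube n) (moved_ident n m) s v' = local_state A 4 (path_cube n) Suc s v"
    for v v'
    using c_chosen[OF that(1)] c'_chosen[OF that(2)] chooses_color_unique that(3) by metis
  have "c' 0 = c 0"
    by (intro same_color local_state_moved_ident_before) (use q in \<open>auto simp: m_def n_def\<close>)
  also have "c 0 = c (8 * q)"
    using proper_4_coloring_path_cube_periodic[OF c, of 0 "2 * q"] q by (simp add: n_def)
  \<comment> \<open>The node at position \<open>8 * q\<close> keeps its color but now occupies
    position \<open>8 * q - 1\<close>, which is 3 modulo 4.\<close>
  also have "c (8 * q) = c' (8 * q - 1)"
    by (intro same_color[symmetric] local_state_moved_ident_after)
      (use q in \<open>auto simp: m_def n_def\<close>)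
  finally have "c' 0 = c' (8 * q - 1)" .
  \<comment> \<open>Periodicity of \<open>c'\<close> carries the color of vertex 0 to a vertex three
    positions before \<open>8 * q - 1\<close>, hence adjacent to it.\<close>
  moreover have "c' (8 * q - 4) = c' 0"
    using proper_4_coloring_path_cube_periodic[OF c', of 0 "2 * q - 1"] q
    by (simp add: n_def diff_mult_distrib2)
  moreover have "(8 * q - 4, 8 * q - 1) \<in> parcs (path_cube n)"
    using q by (auto simp: n_def)
  then have "c' (8 * q - 4) \<noteq> c' (8 * q - 1)"
    using c' unfolding proper_coloring_def by blast
  ultimately show False by simp
qed

end
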